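(* Let $I\subset\mathbb{R}$ be an open interval, $n,q\in\mathbb{N}$, $\alpha,\beta\in\,]-1,+\infty[$ and $f\in C^{n+1+q}(I)$. Then $$\forall x\in I_h,\quad D^{(n)}_{h,\alpha,\beta,q}f(x)=f^{(n)}(x)+O(h^{q+1})$$ (as $h\to0^+$). Moreover, if there exists $M_{n+1+q}>0$ such that $|f^{(n+1+q)}(x)|\le M_{n+1+q}$ for any $x\in I$, then $$\left\|D^{(n)}_{h,\alpha,\beta,q}f(x)-f^{(n)}(x)\right\|_\infty\le C_2h^{q+1},\qquad C_2=\frac{M_{n+1+q}}{(n+1+q)!}\int_{-1}^{1}\left|t^{n+1+q}Q_{\alpha,\beta,n,q}(t)\right|dt.$$
   Context: $\mathbb{N}$ includes $0$. For $h>0$, $I_h:=\{x\in I:\ [x-h,x+h]\subset I\}$, and $\|\cdot\|_\infty$ denotes the supremum over $x\in I_h$. For $\alpha,\beta>-1$: $P_n^{(\alpha,\beta)}(t)=\sum_{j=0}^{n}\binom{n+\alpha}{j}\binom{n+\beta}{n-j}\left(\frac{t-1}{2}\right)^{n-j}\left(\frac{t+1}{2}\right)^{j}$ is the $n$-th Jacobi polynomial, $w_{\alpha,\beta}(t)=(1-t)^{\alpha}(1+t)^{\beta}$, $\langle g_1(\cdot),g_2(\cdot)\rangle_{\alpha,\beta}=\int_{-1}^{1}w_{\alpha,\beta}(t)g_1(t)g_2(t)\,dt$ for $g_1,g_2\in C^0([-1,1])$, and $\|\cdot\|_{\alpha,\beta}$ is the associated norm. With $B(a,b)=\Gamma(a)\Gamma(b)/\Gamma(a+b)$,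 $$\rho_{n,\alpha,\beta}(t)=\frac{2^{-(n+\alpha+\beta+1)}\,n!}{B(n+\alpha+1,n+\beta+1)}P_n^{(\alpha,\beta)}(t)\,w_{\alpha,\beta}(t).$$ The affine estimators are, for $x\in I_h$, $$D^{(n)}_{h,\alpha,\beta,q}f(x)=\sum_{i=0}^{q}\frac{\left\langle P_i^{(\alpha+n,\beta+n)}(\cdot),f^{(n)}(x+h\,\cdot)\right\rangle_{\alpha+n,\beta+n}}{\|P_i^{(\alpha+n,\beta+n)}\|^2_{\alpha+n,\beta+n}}\,P_i^{(\alpha+n,\beta+n)}(0),$$ and $$Q_{\alpha,\beta,n,q}(t)=\sum_{i=0}^{q}P_i^{(\alpha+n,\beta+n)}(0)\sum_{j=0}^{i}(-1)^{i+j}\binom{i}{j}\frac{2i+\alpha+\beta+2n+1}{i+\alpha+\beta+2n+1}\,\rho_{n,\alpha_{i,j},\beta_j}(t),$$ with $\alpha_{i,j}=\alpha+i-j$, $\beta_j=\beta+j$; for $i=0$ the quotient is understood as $1$. *)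

theory Defs
  imports "HOL-Analysis.Analysis" "HOL-Library.Landau_Symbols"
begin

text \<open>Higher derivatives are iterates of \<^const>\<open>deriv\<close>; on an open set they depend only on the
  values of the function on that set.\<close>

definition C_k_on :: "nat \<Rightarrow> real set \<Rightarrow> (real \<Rightarrow> real) \<Rightarrow> bool" where
  "C_k_on k S f \<longleftrightarrow>
     (\<forall>j<k. \<forall>x\<in>S. (deriv ^^ j) f differentiable (at x)) \<and> continuous_on S ((deriv ^^ k) f)"

definition inner_part :: "real set \<Rightarrow> real \<Rightarrow> real set" where
  "inner_part I h = {x \<in> I. {x - h..x + h} \<subseteq> I}"

text \<open>For open \<open>I\<close>, every point of \<open>I\<close> lies in \<open>inner_part I h\<close> for all small \<open>h > 0\<close>, so an
  asymptotic statement for \<open>h \<rightarrow> 0+\<close> at a point of \<open>inner_part I h\<close> makes sense at every point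
  of \<open>I\<close>.\<close>

lemma eventually_in_inner_part:
  assumes "open I" and "x \<in> I"
  shows "eventually (\<lambda>h. x \<in> inner_part I h) (at_right 0)"
proof -
  obtain e where e: "e > 0" "cball x e \<subseteq> I"
    using assms open_contains_cball by blast
  have "x \<in> inner_part I h" if "0 < h" "h < e" for h
  proof -
    have "{x - h..x + h} \<subseteq> cball x e"
      using that by (auto simp: cball_eq_atLeastAtMost)
    then show ?thesis using e assms by (auto simp: inner_part_def)
  qed
  then show ?thesis
    using e by (auto simp: eventually_at_right_field)
qed

text \<open>The supremum is taken in the extended reals, since the set may be empty and the function
  unbounded.\<close>

definition sup_norm_on :: "real set \<Rightarrow> (real \<Rightarrow> real) \<Rightarrow> ereal" where
  "sup_norm_on S g = (SUP x\<in>S. ereal \<bar>g x\<bar>)"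

definition jacobi_poly :: "nat \<Rightarrow> real \<Rightarrow> real \<Rightarrow> real \<Rightarrow> real" where
  "jacobi_poly n \<alpha> \<beta> t =
     (\<Sum>j=0..n. ((real n + \<alpha>) gchoose j) * ((real n + \<beta>) gchoose (n - j))
        * ((t - 1) / 2) ^ (n - j) * ((t + 1) / 2) ^ j)"

text \<open>Since \<open>0 powr a = 0\<close>, this may differ from the usual weight at the endpoints
  \<open>t = -1\<close> and \<open>t = 1\<close>; the weight is only used under integrals.\<close>

definition jacobi_weight :: "real \<Rightarrow> real \<Rightarrow> real \<Rightarrow> real" where
  "jacobi_weight \<alpha> \<beta> t = (1 - t) powr \<alpha> * (1 + t) powr \<beta>"

definition jacobi_inner :: "real \<Rightarrow> real \<Rightarrow> (real \<Rightarrow> real) \<Rightarrow> (real \<Rightarrow> real) \<Rightarrow> real" where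
  "jacobi_inner \<alpha> \<beta> g1 g2 = integral {-1..1} (\<lambda>t. jacobi_weight \<alpha> \<beta> t * g1 t * g2 t)"

definition jacobi_norm :: "real \<Rightarrow> real \<Rightarrow> (real \<Rightarrow> real) \<Rightarrow> real" where
  "jacobi_norm \<alpha> \<beta> g = sqrt (jacobi_inner \<alpha> \<beta> g g)"

definition jacobi_rho :: "nat \<Rightarrow> real \<Rightarrow> real \<Rightarrow> real \<Rightarrow> real" where
  "jacobi_rho n \<alpha> \<beta> t =
     2 powr (- (real n + \<alpha> + \<beta> + 1)) * fact n / Beta (real n + \<alpha> + 1) (real n + \<beta> + 1)
       * jacobi_poly n \<alpha> \<beta> t * jacobi_weight \<alpha> \<beta> t"

definition affine_estimator ::
    "nat \<Rightarrow> real \<Rightarrow> real \<Rightarrow> real \<Rightarrow> nat \<Rightarrow> (real \<Rightarrow> real) \<Rightarrow> real \<Rightarrow> real" where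
  "affine_estimator n h \<alpha> \<beta> q f x =
     (\<Sum>i=0..q.
        jacobi_inner (\<alpha> + real n) (\<beta> + real n)
            (jacobi_poly i (\<alpha> + real n) (\<beta> + real n)) (\<lambda>t. (deriv ^^ n) f (x + h * t))
          / (jacobi_norm (\<alpha> + real n) (\<beta> + real n)
               (jacobi_poly i (\<alpha> + real n) (\<beta> + real n)))\<^sup>2
          * jacobi_poly i (\<alpha> + real n) (\<beta> + real n) 0)"

text \<open>The quotient is \<open>1\<close> for \<open>i = 0\<close>, also in the degenerate case
  \<open>\<alpha> + \<beta> + 2 * n + 1 = 0\<close>, where HOL division would give \<open>0\<close>.\<close>

definition jacobi_Q :: "real \<Rightarrow> real \<Rightarrow> nat \<Rightarrow> nat \<Rightarrow> real \<Rightarrow> real" where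
  "jacobi_Q \<alpha> \<beta> n q t =
     (\<Sum>i=0..q. jacobi_poly i (\<alpha> + real n) (\<beta> + real n) 0 *
        (\<Sum>j=0..i. (-1) ^ (i + j) * real (i choose j)
           * (if i = 0 then 1
              else (2 * real i + \<alpha> + \<beta> + 2 * real n + 1) / (real i + \<alpha> + \<beta> + 2 * real n + 1))
           * jacobi_rho n (\<alpha> + real i - real j) (\<beta> + real j) t))"

end

theory Submission
  imports Defs
begin

text \<open>
  Write \<open>a = \<alpha> + n\<close>, \<open>b = \<beta> + n\<close> and \<open>P_i\<close> for the Jacobi polynomials with parameters \<open>a\<close>, \<open>b\<close>. The
  estimator takes the function \<open>t \<mapsto> f^(n) (x + h t)\<close>, projects it orthogonally onto the polynomials
  of degree at most \<open>q\<close> in the space weighted by \<open>(1 - t)^a (1 + t)^b\<close>, and evaluates the projection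
  at \<open>0\<close>. Two facts determine its error.

  The projection reproduces polynomials of degree at most \<open>q\<close> (\<open>jacobi_projection_poly\<close>). Hence the
  Taylor polynomial of \<open>f\<close> of degree \<open>n + q\<close> at \<open>x\<close> contributes exactly \<open>f^(n)(x)\<close>, and only the
  Taylor remainder contributes to the error.

  The estimator can moreover be written as an integral of \<open>f\<close> itself: if \<open>g\<close> has \<open>n\<close> continuous
  derivatives, then
  the projection of \<open>g^(n)\<close> evaluated at \<open>0\<close> is the integral of \<open>Q g\<close> over \<open>[-1, 1]\<close>
  (\<open>jacobi_Q_represents_projection\<close>). Inserting the remainder, which is bounded by
  \<open>M |h t|^(n+1+q) / (n+1+q)!\<close>, and cancelling the factor \<open>h^n\<close> that comes from differentiating
  \<open>t \<mapsto> f (x + h t)\<close>, gives the constant of the theorem (\<open>affine_estimator_error\<close>). The pointwise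
  order follows by using this estimate on a compact neighbourhood of the point.

  Both facts rest on one differentiation rule, a step of Rodrigues' formula: the derivative of
  \<open>w_(a+1,b+1) P_n^(a+1,b+1)\<close> is \<open>- 2 (n + 1) w_(a,b) P_(n+1)^(a,b)\<close> (\<open>jacobi_weight_poly_deriv\<close>).
  Repeated integration by parts (\<open>jacobi_inner_by_parts\<close>) then yields orthogonality and the norms of
  the Jacobi polynomials, and it moves the \<open>n\<close> derivatives from \<open>g\<close> to the kernel. The remaining
  ingredient is algebraic: \<open>w_(a,b) P_i\<close> divided by the squared norm of \<open>P_i\<close> is an alternating
  combination of normalized weights with exponents \<open>a + i - j\<close> and \<open>b + j\<close>
  (\<open>jacobi_kernel_expansion\<close>).
\<close>

section \<open>The Jacobi weight\<close>
lemma jacobi_weight_nonneg: "0 \<le> jacobi_weight a b t"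
  by (simp add: jacobi_weight_def)

text \<open>
  The substitution \<open>t = (1 + s) / 2\<close> turns this integral into the Euler integral for Beta.
\<close>
lemma jacobi_weight_has_integral:
  assumes "a > -1" "b > -1"
  shows "(jacobi_weight a b has_integral 2 powr (a + b + 1) * Beta (a + 1) (b + 1)) {-1..1}"
proof -
  let ?f = "\<lambda>t::real. t powr (b + 1 - 1) * (1 - t) powr (a + 1 - 1)"
  have "(?f has_integral Beta (b + 1) (a + 1)) (cbox 0 1)"
    using has_integral_Beta_real[of "b + 1" "a + 1"] assms by simp
  from has_integral_affinity'[OF this, of "1/2" "1/2"]
  have "((\<lambda>s. ?f (s / 2 + 1 / 2)) has_integral 2 * Beta (b + 1) (a + 1)) {-1..1}"
    by simp
  then have "((\<lambda>s. 2 powr (a + b) * ?f (s / 2 + 1 / 2)) has_integral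
                2 powr (a + b) * (2 * Beta (b + 1) (a + 1))) {-1..1}"
    by (rule has_integral_mult_right)
  then have "(jacobi_weight a b has_integral 2 powr (a + b) * (2 * Beta (b + 1) (a + 1))) {-1..1}"
  proof (rule has_integral_eq[rotated])
    fix s :: real assume s: "s \<in> {-1..1}"
    have *: "s / 2 + 1 / 2 = (1 + s) / 2" "1 - (1 + s) / 2 = (1 - s) / 2"
      by (auto simp: field_simps)
    show "2 powr (a + b) * ?f (s / 2 + 1 / 2) = jacobi_weight a b s"
      using s unfolding * jacobi_weight_def by (simp add: powr_divide powr_add)
  qed
  then show ?thesis
    by (simp add: powr_add Beta_commute mult_ac)
qed

text \<open>
  For a negative exponent the weight is unbounded, so absolute integrability of the products
  comes from nonnegativity of the weight and boundedness of the continuous factor.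
\<close>
lemma jacobi_weight_times_continuous_absolutely_integrable:
  assumes "a > -1" "b > -1" "continuous_on {-1..1} g"
  shows "(\<lambda>t. jacobi_weight a b t * g t) absolutely_integrable_on {-1..1}"
proof -
  have w: "jacobi_weight a b absolutely_integrable_on {-1..1}"
    using jacobi_weight_has_integral[OF assms(1,2)]
    by (intro nonnegative_absolutely_integrable_1 jacobi_weight_nonneg)
       (auto simp: integrable_on_def)
  have "g \<in> borel_measurable (lebesgue_on {-1..1})"
    by (rule continuous_imp_measurable_on_sets_lebesgue[OF assms(3)]) auto
  moreover have "bounded (g ` {-1..1})"
    using assms(3) compact_continuous_image compact_imp_bounded by blast
  ultimately have "(\<lambda>t. g t * jacobi_weight a b t) absolutely_integrable_on {-1..1}"
    using w by (intro absolutely_integrable_bounded_measurable_product_real) auto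
  then show ?thesis
    by (simp add: mult.commute)
qed

lemma continuous_on_jacobi_poly [continuous_intros]:
  "continuous_on S (jacobi_poly n a b)"
  unfolding jacobi_poly_def by (intro continuous_intros) auto

lemma jacobi_poly_0 [simp]: "jacobi_poly 0 a b t = 1"
  by (simp add: jacobi_poly_def)

text \<open>
  These are the factors produced by differentiating the powers of \<open>1 - t\<close> and \<open>1 + t\<close>; absorbing
  them shifts the lower index, which is what turns degree \<open>n\<close> into degree \<open>n + 1\<close> below.
\<close>
lemma gbinomial_lower_absorb:
  "(A - real j) * (A gchoose j) = real (Suc j) * (A gchoose Suc j)"
  using gbinomial_mult_1[of A j] by (simp add: algebra_simps)

section \<open>Rodrigues' formula and integration by parts\<close>

text \<open>
  One step of Rodrigues' formula. With \<open>u = (t - 1) / 2\<close> and \<open>v = (t + 1) / 2\<close> one has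
  \<open>(1 - t)(1 + t) = - 4 u v\<close>, so differentiating \<open>w u^(n-j) v^j\<close> yields
  \<open>- 2 w\<close> times a combination of \<open>u^(n-j) v^(j+1)\<close> and \<open>u^(n-j+1) v^j\<close>. After absorption the
  monomial \<open>u^(n+1-k) v^k\<close> collects the factor \<open>k\<close> from the first kind and \<open>n + 1 - k\<close> from the
  second, and these add up to \<open>n + 1\<close> for every \<open>k\<close>.
\<close>
lemma jacobi_weight_poly_deriv:
  assumes t: "-1 < t" "t < 1"
  shows "((\<lambda>t. jacobi_weight (a + 1) (b + 1) t * jacobi_poly n (a + 1) (b + 1) t)
            has_real_derivative
          - 2 * real (Suc n) * (jacobi_weight a b t * jacobi_poly (Suc n) a b t)) (at t)"
proof -
  define A where "A = real (Suc n) + a"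
  define B where "B = real (Suc n) + b"
  define c where "c j = (A gchoose j) * (B gchoose (n - j))" for j
  define u where "u t = (t - 1) / 2" for t :: real
  define v where "v t = (t + 1) / 2" for t :: real
  define e where "e k = (A gchoose k) * (B gchoose (Suc n - k)) * u t ^ (Suc n - k) * v t ^ k" for k
  have W: "(jacobi_weight (a + 1) (b + 1) has_real_derivative
              jacobi_weight a b t * ((b + 1) * (1 - t) - (a + 1) * (1 + t))) (at t)"
  proof -
    have "((\<lambda>t. (1 - t) powr (a + 1)) has_real_derivative (a + 1) * (1 - t) powr a * (- 1)) (at t)"
      using DERIV_fun_powr[of "\<lambda>t. 1 - t" "- 1" t "a + 1"] t
      by (auto intro!: derivative_eq_intros)
    moreover have "((\<lambda>t. (1 + t) powr (b + 1)) has_real_derivative (b + 1) * (1 + t) powr b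
        * 1) (at t)"
      using DERIV_fun_powr[of "\<lambda>t. 1 + t" 1 t "b + 1"] t
      by (auto intro!: derivative_eq_intros)
    ultimately show ?thesis
      unfolding jacobi_weight_def
      by (rule DERIV_cong[OF DERIV_mult]) (use t in \<open>simp add: powr_add algebra_simps\<close>)
  qed
  have U: "(u has_real_derivative 1 / 2) (at t)" and V: "(v has_real_derivative 1 / 2) (at t)"
    unfolding u_def v_def by (auto intro!: derivative_eq_intros)
  have T: "((\<lambda>t. jacobi_weight (a + 1) (b + 1) t * (c j * u t ^ (n - j) * v t ^ j))
             has_real_derivative
           - 2 * jacobi_weight a b t * (c j * ((A - real j) * u t ^ (n - j) * v t ^ Suc j
              + (B - real (n - j)) * u t ^ Suc (n - j) * v t ^ j))) (at t)" if "j \<le> n" for j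
  proof -
    define m where "m = n - j"
    have P: "((\<lambda>t. c j * u t ^ m * v t ^ j) has_real_derivative
                c j * (real m * u t ^ (m - 1) * v t ^ j + real j * u t ^ m * v t ^ (j - 1))
                    / 2) (at t)"
      by (rule derivative_eq_intros U V refl)+ (simp add: field_simps)
    have w: "jacobi_weight (a + 1) (b + 1) t = jacobi_weight a b t * (- 4 * u t * v t)"
      using t by (simp add: jacobi_weight_def powr_add u_def v_def field_simps)
    \<comment> \<open>The exponents \<open>m - 1\<close> and \<open>j - 1\<close> are harmless at zero because of the factors \<open>m\<close> and \<open>j\<close>.\<close>
    have pm: "real m * u t ^ (m - 1) * u t = real m * u t ^ m"
      by (cases m) auto
    have pj: "real j * v t ^ (j - 1) * v t = real j * v t ^ j"
      by (cases j) auto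
    have uv: "1 - t = - 2 * u t" "1 + t = 2 * v t"
      by (auto simp: u_def v_def)
    have "(- 4 * u t * v t) * (c j * (real m * u t ^ (m - 1) * v t ^ j + real j * u t ^ m
        * v t ^ (j - 1)) / 2)
        = - 2 * c j * ((real m * u t ^ (m - 1) * u t) * v t ^ j * v t
                     + u t ^ m * (real j * v t ^ (j - 1) * v t) * u t)"
      by (simp add: field_simps)
    also have "\<dots> = - 2 * c j * (real m * u t ^ m * v t ^ Suc j + real j * u t ^ Suc m * v t ^ j)"
      unfolding pm pj by (simp add: algebra_simps)
    finally have D: "(- 4 * u t * v t) * (c j * (real m * u t ^ (m - 1) * v t ^ j + real j
        * u t ^ m * v t ^ (j - 1)) / 2)
        = - 2 * c j * (real m * u t ^ m * v t ^ Suc j + real j * u t ^ Suc m * v t ^ j)" .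
    have AB: "A = a + 1 + real m + real j" "B = b + 1 + real m + real j"
      using that by (auto simp: A_def B_def m_def)
    have "((\<lambda>t. jacobi_weight (a + 1) (b + 1) t * (c j * u t ^ m * v t ^ j)) has_real_derivative
        jacobi_weight a b t * ((b + 1) * (1 - t) - (a + 1) * (1 + t)) * (c j * u t ^ m * v t ^ j)
        + c j * (real m * u t ^ (m - 1) * v t ^ j + real j * u t ^ m * v t ^ (j - 1)) / 2
          * jacobi_weight (a + 1) (b + 1) t) (at t)"
      by (rule DERIV_mult[OF W P])
    also have "jacobi_weight a b t * ((b + 1) * (1 - t) - (a + 1) * (1 + t)) * (c j * u t ^ m
        * v t ^ j)
        + c j * (real m * u t ^ (m - 1) * v t ^ j + real j * u t ^ m * v t ^ (j - 1)) / 2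
          * jacobi_weight (a + 1) (b + 1) t
        = jacobi_weight a b t * (((b + 1) * (- 2 * u t) - (a + 1) * (2 * v t)) * (c j * u t ^ m
            * v t ^ j)
          + (- 4 * u t * v t) * (c j * (real m * u t ^ (m - 1) * v t ^ j + real j * u t ^ m
              * v t ^ (j - 1)) / 2))"
      unfolding w uv by (simp only: algebra_simps)
    also have "\<dots> = - 2 * jacobi_weight a b t * (c j * ((A - real j) * u t ^ m * v t ^ Suc j
              + (B - real m) * u t ^ Suc m * v t ^ j))"
      unfolding D AB by (simp add: algebra_simps)
    finally show ?thesis
      unfolding m_def .
  qed
  have S1: "(\<Sum>j=0..n. c j * ((A - real j) * u t ^ (n - j) * v t ^ Suc j)) = (\<Sum>k=0..Suc n. real k
      * e k)"
  proof -
    have "(\<Sum>k=0..Suc n. real k * e k) = (\<Sum>j=0..n. real (Suc j) * e (Suc j))"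
      by (subst sum.atLeast0_atMost_Suc_shift) simp
    also have "\<dots> = (\<Sum>j=0..n. c j * ((A - real j) * u t ^ (n - j) * v t ^ Suc j))"
    proof (rule sum.cong)
      fix j
      show "real (Suc j) * e (Suc j) = c j * ((A - real j) * u t ^ (n - j) * v t ^ Suc j)"
        using gbinomial_lower_absorb[of A j, symmetric]
        unfolding e_def c_def by (simp add: mult_ac)
    qed simp
    finally show ?thesis by simp
  qed
  have S2: "(\<Sum>j=0..n. c j * ((B - real (n - j)) * u t ^ Suc (n - j) * v t ^ j))
              = (\<Sum>k=0..Suc n. (real (Suc n) - real k) * e k)"
  proof -
    have "(\<Sum>k=0..Suc n. (real (Suc n) - real k) * e k) = (\<Sum>j=0..n. (real (Suc n) - real j) * e j)"
      by simp
    also have "\<dots> = (\<Sum>j=0..n. c j * ((B - real (n - j)) * u t ^ Suc (n - j) * v t ^ j))"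
    proof (rule sum.cong)
      fix j assume "j \<in> {0..n}"
      then have j: "Suc n - j = Suc (n - j)" "real (Suc n) - real j = real (Suc (n - j))"
        by auto
      show "(real (Suc n) - real j) * e j = c j * ((B - real (n - j)) * u t ^ Suc (n - j)
          * v t ^ j)"
        using gbinomial_lower_absorb[of B "n - j", symmetric]
        unfolding e_def c_def j by (simp add: mult_ac)
    qed simp
    finally show ?thesis by simp
  qed
  have "((\<lambda>t. \<Sum>j=0..n. jacobi_weight (a + 1) (b + 1) t * (c j * u t ^ (n - j) * v t ^ j))
          has_real_derivative
         (\<Sum>j=0..n. - 2 * jacobi_weight a b t * (c j * ((A - real j) * u t ^ (n - j) * v t ^ Suc j
              + (B - real (n - j)) * u t ^ Suc (n - j) * v t ^ j)))) (at t)"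
    by (rule DERIV_sum) (use T in auto)
  also have "(\<lambda>t. \<Sum>j=0..n. jacobi_weight (a + 1) (b + 1) t * (c j * u t ^ (n - j) * v t ^ j))
      = (\<lambda>t. jacobi_weight (a + 1) (b + 1) t * jacobi_poly n (a + 1) (b + 1) t)"
    by (simp add: jacobi_poly_def sum_distrib_left c_def A_def B_def u_def v_def add_ac)
  also have "(\<Sum>j=0..n. - 2 * jacobi_weight a b t * (c j * ((A - real j) * u t ^ (n - j)
      * v t ^ Suc j
              + (B - real (n - j)) * u t ^ Suc (n - j) * v t ^ j)))
      = - 2 * jacobi_weight a b t * ((\<Sum>j=0..n. c j * ((A - real j) * u t ^ (n - j) * v t ^ Suc j))
          + (\<Sum>j=0..n. c j * ((B - real (n - j)) * u t ^ Suc (n - j) * v t ^ j)))"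
    unfolding sum_distrib_left sum.distrib[symmetric] by (intro sum.cong) (simp_all add:
        algebra_simps)
  also have "\<dots> = - 2 * jacobi_weight a b t * (\<Sum>k=0..Suc n. real (Suc n) * e k)"
    unfolding S1 S2 sum.distrib[symmetric] by (simp only: algebra_simps) simp
  also have "\<dots> = - 2 * real (Suc n) * (jacobi_weight a b t * (\<Sum>k=0..Suc n. e k))"
    unfolding sum_distrib_left[of "real (Suc n)", symmetric] by (simp only: mult_ac)
  also have "(\<Sum>k=0..Suc n. e k) = jacobi_poly (Suc n) a b t"
    by (simp only: jacobi_poly_def e_def A_def B_def u_def v_def)
  finally show ?thesis .
qed

text \<open>
  The boundary terms vanish because the exponents \<open>a + 1\<close> and \<open>b + 1\<close> are positive. At the endpoints
  the product is continuous but, if the weight blows up there, not differentiable; hence the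
  fundamental
  theorem is used in its version with derivatives in the interior only.
\<close>
lemma jacobi_inner_by_parts_once:
  assumes a: "a > -1" and b: "b > -1"
    and cont: "continuous_on {-1..1} g" "continuous_on {-1..1} g'"
    and der: "\<And>t. -1 < t \<Longrightarrow> t < 1 \<Longrightarrow> (g has_real_derivative g' t) (at t)"
  shows "jacobi_inner a b (jacobi_poly (Suc n) a b) g
           = jacobi_inner (a + 1) (b + 1) (jacobi_poly n (a + 1) (b + 1)) g' / (2 * real (Suc n))"
proof -
  let ?w = "jacobi_weight a b" and ?P = "jacobi_poly (Suc n) a b"
  let ?w' = "jacobi_weight (a + 1) (b + 1)" and ?P' = "jacobi_poly n (a + 1) (b + 1)"
  have int: "(\<lambda>t. ?w t * (?P t * g t)) integrable_on {-1..1}"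
            "(\<lambda>t. ?w' t * (?P' t * g' t)) integrable_on {-1..1}"
    using a b cont
    by (auto intro!: set_lebesgue_integral_eq_integral(1) continuous_intros
          jacobi_weight_times_continuous_absolutely_integrable)
  have "((\<lambda>t. - 2 * real (Suc n) * (?w t * ?P t) * g t + g' t * (?w' t * ?P' t)) has_integral
          ?w' 1 * ?P' 1 * g 1 - ?w' (-1) * ?P' (-1) * g (-1)) {-1..1}"
  proof (rule fundamental_theorem_of_calculus_interior)
    have "continuous_on {-1..1} (\<lambda>t::real. (1 - t) powr (a + 1))"
         "continuous_on {-1..1} (\<lambda>t::real. (1 + t) powr (b + 1))"
      by (rule continuous_on_powr'; use a b in \<open>auto intro!: continuous_intros\<close>)+
    then show "continuous_on {-1..1} (\<lambda>t. ?w' t * ?P' t * g t)"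
      unfolding jacobi_weight_def
      by (intro continuous_on_mult continuous_on_jacobi_poly cont)
  next
    fix t :: real assume "t \<in> {-1<..<1}"
    then show "((\<lambda>t. ?w' t * ?P' t * g t) has_vector_derivative
                - 2 * real (Suc n) * (?w t * ?P t) * g t + g' t * (?w' t * ?P' t)) (at t)"
      unfolding has_real_derivative_iff_has_vector_derivative[symmetric]
      by (intro DERIV_mult jacobi_weight_poly_deriv der) auto
  qed simp
  then have "((\<lambda>t. - 2 * real (Suc n) * (?w t * (?P t * g t)) + ?w' t * (?P' t
      * g' t)) has_integral 0) {-1..1}"
    by (simp add: jacobi_weight_def mult_ac)
  then have "integral {-1..1} (\<lambda>t. - 2 * real (Suc n) * (?w t * (?P t * g t)) + ?w' t * (?P' t
      * g' t)) = 0"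
    by (rule integral_unique)
  moreover have "integral {-1..1} (\<lambda>t. - 2 * real (Suc n) * (?w t * (?P t * g t)) + ?w' t
      * (?P' t * g' t))
      = - 2 * real (Suc n) * integral {-1..1} (\<lambda>t. ?w t * (?P t * g t))
          + integral {-1..1} (\<lambda>t. ?w' t * (?P' t * g' t))"
    by (subst integral_add[OF integrable_on_mult_right[OF int(1)] int(2)]) (simp only:
        integral_mult_right)
  ultimately show ?thesis
    by (simp add: jacobi_inner_def field_simps mult.assoc)
qed

text \<open>
  The family \<open>G\<close> lists the successive derivatives of \<open>G 0\<close> explicitly. Polynomials and Taylor
  remainders come with such families, and on the endpoints only continuity is then asked of
  them, whereas
  iterates of \<^const>\<open>deriv\<close> would depend on values outside the interval.
\<close>
lemma jacobi_inner_by_parts: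
  assumes a: "a > -1" and b: "b > -1"
    and cont: "\<And>k. k \<le> n \<Longrightarrow> continuous_on {-1..1} (G k)"
    and der: "\<And>k t. k < n \<Longrightarrow> -1 < t \<Longrightarrow> t < 1 \<Longrightarrow> (G k has_real_derivative G (Suc k) t) (at t)"
  shows "jacobi_inner a b (jacobi_poly n a b) (G 0)
           = jacobi_inner (a + real n) (b + real n) (\<lambda>_. 1) (G n) / (2 ^ n * fact n)"
  using assms
proof (induction n arbitrary: a b G)
  case 0
  then show ?case by (simp add: jacobi_inner_def)
next
  case (Suc n)
  have "jacobi_inner a b (jacobi_poly (Suc n) a b) (G 0)
      = jacobi_inner (a + 1) (b + 1) (jacobi_poly n (a + 1) (b + 1)) (G (Suc 0)) / (2
          * real (Suc n))"
    using Suc.prems by (intro jacobi_inner_by_parts_once) auto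
  also have "jacobi_inner (a + 1) (b + 1) (jacobi_poly n (a + 1) (b + 1)) (G (Suc 0))
      = jacobi_inner (a + 1 + real n) (b + 1 + real n) (\<lambda>_. 1) (G (Suc n)) / (2 ^ n * fact n)"
    using Suc.prems by (intro Suc.IH[of "a + 1" "b + 1" "\<lambda>k. G (Suc k)"]) auto
  finally show ?case
    by (simp add: add_ac mult_ac)
qed

section \<open>Orthogonality and norms\<close>
definition jacobi_as_poly :: "nat \<Rightarrow> real \<Rightarrow> real \<Rightarrow> real poly" where
  "jacobi_as_poly n a b =
     (\<Sum>j=0..n. smult (((real n + a) gchoose j) * ((real n + b) gchoose (n - j)))
        ([:- (1 / 2), 1 / 2:] ^ (n - j) * [:1 / 2, 1 / 2:] ^ j))"

lemma poly_jacobi_as_poly: "poly (jacobi_as_poly n a b) = jacobi_poly n a b"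
  by (auto simp: jacobi_as_poly_def jacobi_poly_def poly_sum fun_eq_iff algebra_simps
      diff_divide_distrib
      add_divide_distrib intro!: sum.cong)

lemma degree_halves_power:
  assumes "j \<le> n"
  shows "degree ([:- (1 / 2), 1 / 2:] ^ (n - j) * [:1 / 2, 1 / 2:] ^ j :: real poly) = n"
  using assms by (simp add: degree_mult_eq degree_power_eq)

lemma degree_jacobi_as_poly: "degree (jacobi_as_poly n a b) \<le> n"
  unfolding jacobi_as_poly_def
  by (intro degree_sum_le order.trans[OF degree_smult_le]) (auto simp: degree_halves_power)

text \<open>
  Every summand has leading coefficient \<open>2^-n\<close>, and Vandermonde's convolution sums the binomials.
\<close>
lemma coeff_jacobi_as_poly:
  "coeff (jacobi_as_poly n a b) n = ((2 * real n + a + b) gchoose n) / 2 ^ n"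
proof -
  have "coeff ([:- (1 / 2), 1 / 2:] ^ (n - j) * [:1 / 2, 1 / 2:] ^ j :: real poly) n = 1 / 2 ^ n"
    if "j \<le> n" for j
  proof -
    have "coeff ([:- (1 / 2), 1 / 2:] ^ (n - j) * [:1 / 2, 1 / 2:] ^ j :: real poly) n
        = lead_coeff ([:- (1 / 2), 1 / 2:] ^ (n - j) * [:1 / 2, 1 / 2:] ^ j :: real poly)"
      using that by (simp only: degree_halves_power)
    also have "\<dots> = (1 / 2) ^ (n - j) * (1 / 2) ^ j"
      by (simp only: lead_coeff_mult lead_coeff_power) simp
    also have "\<dots> = 1 / 2 ^ n"
      using that by (simp add: power_add[symmetric] power_one_over)
    finally show ?thesis .
  qed
  then have "coeff (jacobi_as_poly n a b) n
      = (\<Sum>j=0..n. ((real n + a) gchoose j) * ((real n + b) gchoose (n - j))) / 2 ^ n"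
    unfolding jacobi_as_poly_def coeff_sum coeff_smult sum_divide_distrib
    by (intro sum.cong) simp_all
  also have "(\<Sum>j=0..n. ((real n + a) gchoose j) * ((real n + b) gchoose (n - j)))
      = (2 * real n + a + b) gchoose n"
    by (subst gbinomial_Vandermonde) (simp add: algebra_simps)
  finally show ?thesis .
qed

lemma jacobi_inner_one:
  assumes "a > -1" "b > -1"
  shows "jacobi_inner a b (\<lambda>_. 1) (\<lambda>_. c) = c * (2 powr (a + b + 1) * Beta (a + 1) (b + 1))"
  using integral_unique[OF jacobi_weight_has_integral[OF assms]]
  by (simp add: jacobi_inner_def mult.commute)

text \<open>
  Integrating by parts \<open>d\<close> times leaves only the constant \<open>d! coeff p d\<close> of \<open>p\<close>. For \<open>degree p < d\<close>
  this is orthogonality to lower degrees; for \<open>p = P_d\<close> it computes the norm.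
\<close>
lemma jacobi_inner_poly_degree_le:
  assumes a: "a > -1" and b: "b > -1" and p: "degree p \<le> d"
  shows "jacobi_inner a b (jacobi_poly d a b) (poly p)
           = coeff p d * 2 powr (a + b + real d + 1) * Beta (a + real d + 1) (b + real d + 1)"
proof -
  have "(pderiv ^^ d) p = [:fact d * coeff p d:]"
    using p by (auto intro!: poly_eqI simp: coeff_higher_pderiv pochhammer_fact coeff_pCons
        coeff_eq_0
        split: nat.splits)
  then have D: "poly ((pderiv ^^ d) p) = (\<lambda>_. fact d * coeff p d)"
    by (auto simp: fun_eq_iff)
  have "jacobi_inner a b (jacobi_poly d a b) (poly ((pderiv ^^ 0) p))
      = jacobi_inner (a + real d) (b + real d) (\<lambda>_. 1) (poly ((pderiv ^^ d) p)) / (2 ^ d * fact d)"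
    using a b by (intro jacobi_inner_by_parts) (auto intro!: continuous_intros poly_DERIV)
  also have "\<dots> = coeff p d * 2 powr (a + real d + (b + real d) + 1) / 2 ^ d
      * Beta (a + real d + 1) (b + real d + 1)"
    unfolding D using a b by (subst jacobi_inner_one) auto
  also have "2 powr (a + real d + (b + real d) + 1) = 2 powr (a + b + real d + 1) * 2 powr real d"
    by (simp add: powr_add[symmetric] algebra_simps)
  also have "2 powr real d = 2 ^ d"
    by (simp add: powr_realpow)
  finally show ?thesis by simp
qed

text \<open>
  The quantity multiplied by the quotient is, up to a power of two, the squared norm of \<open>P_i\<close>
  (see \<open>jacobi_norm_squared\<close>). The Gamma values at \<open>2 i + a + b + 1\<close> cancel up to a factor
  \<open>2 i + a + b + 1\<close> left in the denominator, which the quotient removes. For \<open>i = 0\<close> this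
  argument may
  be the pole \<open>0\<close> of Gamma, but then the product is a single Beta value, in agreement with the
  value \<open>1\<close> of the
  quotient.
\<close>
lemma gbinomial_Beta_ratio:
  fixes a b :: real
  assumes a: "a > -1" and b: "b > -1"
  shows "(if i = 0 then 1 else (2 * real i + a + b + 1) / (real i + a + b + 1))
           * (((2 * real i + a + b) gchoose i) * Beta (a + real i + 1) (b + real i + 1))
         = Gamma (a + real i + 1) * Gamma (b + real i + 1) / (fact i * Gamma (a + b + real i + 2))"
proof (cases "i = 0")
  case True
  then show ?thesis by (simp add: Beta_def add_ac)
next
  case False
  \<comment> \<open>For \<open>i \<ge> 1\<close> this number is positive, so Gamma satisfies its recursion there.\<close>
  define s where "s = real i + a + b + 1"
  have s: "s > 0" "s + real i > 0" using False a b by (auto simp: s_def)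
  have 1: "((2 * real i + a + b) gchoose i) = Gamma (s + real i) / (fact i * Gamma s)"
    using s by (subst gbinomial_Gamma) (auto simp: s_def algebra_simps nonpos_Ints_def)
  have 2: "Beta (a + real i + 1) (b + real i + 1)
      = Gamma (a + real i + 1) * Gamma (b + real i + 1) / Gamma (s + real i + 1)"
    by (simp add: Beta_def s_def algebra_simps)
  have "s + real i \<notin> \<int>\<^sub>\<le>\<^sub>0" "s \<notin> \<int>\<^sub>\<le>\<^sub>0"
    using s by auto
  then have 3: "Gamma (s + real i + 1) = (s + real i) * Gamma (s + real i)"
      and Gs: "Gamma (s + 1) = s * Gamma s"
    by (blast intro: Gamma_plus1)+
  have "a + b + real i + 2 = s + 1"
    by (simp add: s_def)
  with Gs have 4: "Gamma (a + b + real i + 2) = s * Gamma s"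
    by (simp only:)
  have 5: "2 * real i + a + b + 1 = s + real i" "real i + a + b + 1 = s"
    by (auto simp: s_def)
  have "Gamma s \<noteq> 0" "Gamma (s + real i) \<noteq> 0"
    using s by (metis Gamma_real_pos less_irrefl)+
  then show ?thesis
    unfolding 1 2 3 4 5 using s False by simp
qed

lemma gbinomial_times_Beta_nonzero:
  fixes a b :: real
  assumes "a > -1" and "b > -1"
  shows "((2 * real i + a + b) gchoose i) * Beta (a + real i + 1) (b + real i + 1) \<noteq> 0"
proof
  assume *: "((2 * real i + a + b) gchoose i) * Beta (a + real i + 1) (b + real i + 1) = 0"
  have "Gamma (a + real i + 1) * Gamma (b + real i + 1) / (fact i * Gamma (a + b + real i + 2)) = 0"
    by (simp only: gbinomial_Beta_ratio[OF assms, of i, unfolded *, symmetric] mult_zero_right)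
  moreover have "Gamma (a + real i + 1) > 0" "Gamma (b + real i + 1) > 0"
    using assms by (auto intro!: Gamma_real_pos)
  moreover have "Gamma (a + b + real i + 2) > 0"
    using assms by (intro Gamma_real_pos) linarith
  ultimately show False
    by (metis divide_eq_0_iff fact_nonzero less_irrefl mult_eq_0_iff)
qed

lemma jacobi_inner_integrable:
  assumes "a > -1" "b > -1" "continuous_on {-1..1} g" "continuous_on {-1..1} \<phi>"
  shows "(\<lambda>t. jacobi_weight a b t * g t * \<phi> t) integrable_on {-1..1}"
  unfolding mult.assoc
  by (intro set_lebesgue_integral_eq_integral(1) continuous_on_mult
        jacobi_weight_times_continuous_absolutely_integrable assms)

lemma jacobi_norm_squared_eq_inner:
  assumes "a > -1" "b > -1" "continuous_on {-1..1} g"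
  shows "(jacobi_norm a b g)\<^sup>2 = jacobi_inner a b g g"
proof -
  have "0 \<le> jacobi_weight a b t * g t * g t" for t
    by (simp add: jacobi_weight_nonneg mult.assoc)
  then have "0 \<le> jacobi_inner a b g g"
    unfolding jacobi_inner_def
    by (intro integral_nonneg jacobi_inner_integrable assms) auto
  then show ?thesis
    by (simp add: jacobi_norm_def)
qed

lemma jacobi_norm_squared:
  assumes a: "a > -1" and b: "b > -1"
  shows "(jacobi_norm a b (jacobi_poly i a b))\<^sup>2
           = 2 powr (a + b + 1) * (((2 * real i + a + b) gchoose i) * Beta (a + real i + 1) (b
               + real i + 1))"
proof -
  have "(jacobi_norm a b (jacobi_poly i a b))\<^sup>2 = jacobi_inner a b (jacobi_poly i a b)
      (jacobi_poly i a b)"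
    by (rule jacobi_norm_squared_eq_inner[OF a b continuous_on_jacobi_poly])
  also have "\<dots> = ((2 * real i + a + b) gchoose i) / 2 ^ i * 2 powr (a + b + real i + 1)
      * Beta (a + real i + 1) (b + real i + 1)"
    using jacobi_inner_poly_degree_le[OF a b degree_jacobi_as_poly[of i a b]]
    by (simp add: poly_jacobi_as_poly coeff_jacobi_as_poly)
  also have "2 powr (a + b + real i + 1) = 2 powr (a + b + 1) * 2 ^ i"
    by (simp add: powr_add powr_realpow)
  finally show ?thesis by simp
qed

section \<open>Projection onto polynomials\<close>

text \<open>
  The value at \<open>0\<close> of the weighted orthogonal projection onto the polynomials of degree less than
  \<open>q\<close>. The strict bound lets inductions start from the zero polynomial.
\<close>
definition jacobi_projection_at_0 :: "real \<Rightarrow> real \<Rightarrow> nat \<Rightarrow> (real \<Rightarrow> real) \<Rightarrow> real" where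
  "jacobi_projection_at_0 a b q \<phi> =
     (\<Sum>i<q. jacobi_inner a b (jacobi_poly i a b) \<phi> / (jacobi_norm a b (jacobi_poly i a b))\<^sup>2
              * jacobi_poly i a b 0)"

lemma jacobi_inner_add_mult:
  assumes "a > -1" "b > -1" "continuous_on {-1..1} g" "continuous_on {-1..1} \<phi>" "continuous_on
      {-1..1} \<psi>"
  shows "jacobi_inner a b g (\<lambda>t. \<phi> t + c * \<psi> t) = jacobi_inner a b g \<phi> + c * jacobi_inner a b g \<psi>"
proof -
  have "integral {-1..1} (\<lambda>t. jacobi_weight a b t * g t * \<phi> t + c * (jacobi_weight a b t * g t
      * \<psi> t))
      = jacobi_inner a b g \<phi> + c * jacobi_inner a b g \<psi>"
    unfolding jacobi_inner_def
    by (subst integral_add[OF jacobi_inner_integrable integrable_on_mult_right[OF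
        jacobi_inner_integrable]])
       (simp_all only: assms integral_mult_right)
  then show ?thesis
    by (simp add: jacobi_inner_def algebra_simps)
qed

lemma jacobi_projection_add_mult:
  assumes "a > -1" "b > -1" "continuous_on {-1..1} \<phi>" "continuous_on {-1..1} \<psi>"
  shows "jacobi_projection_at_0 a b q (\<lambda>t. \<phi> t + c * \<psi> t)
           = jacobi_projection_at_0 a b q \<phi> + c * jacobi_projection_at_0 a b q \<psi>"
  unfolding jacobi_projection_at_0_def jacobi_inner_add_mult[OF assms(1,2)
      continuous_on_jacobi_poly assms(3,4)]
  by (simp add: sum.distrib sum_distrib_left add_divide_distrib distrib_right mult.assoc)

lemma jacobi_inner_commute: "jacobi_inner a b g \<phi> = jacobi_inner a b \<phi> g"
  by (simp add: jacobi_inner_def mult_ac)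

text \<open>
  A projection fixes its range. By induction on \<open>q\<close>: subtracting a multiple of \<open>P_q\<close> removes the
  coefficient of degree \<open>q\<close>, and the remainder is orthogonal to \<open>P_q\<close> because its degree is
  smaller.
\<close>
lemma jacobi_projection_poly:
  assumes a: "a > -1" and b: "b > -1" and p: "\<And>k. k \<ge> q \<Longrightarrow> coeff p k = 0"
  shows "jacobi_projection_at_0 a b q (poly p) = poly p 0"
  using p
proof (induction q arbitrary: p)
  case 0
  then have "p = 0" by (intro poly_eqI) auto
  then show ?case by (simp add: jacobi_projection_at_0_def)
next
  case (Suc q)
  let ?J = "jacobi_as_poly q a b"
  have nz: "coeff ?J q \<noteq> 0" and nz': "(jacobi_norm a b (jacobi_poly q a b))\<^sup>2 \<noteq> 0"
    using gbinomial_times_Beta_nonzero[OF a b, of q] jacobi_norm_squared[OF a b, of q]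
    by (auto simp: coeff_jacobi_as_poly)
  define c where "c = coeff p q / coeff ?J q"
  define r where "r = p - smult c ?J"
  have r: "coeff r k = 0" if "k \<ge> q" for k
  proof (cases "k = q")
    case True
    then show ?thesis using nz by (simp add: r_def c_def)
  next
    case False
    then have "coeff p k = 0" "coeff ?J k = 0"
      using that Suc.prems degree_jacobi_as_poly[of q a b] by (auto intro: coeff_eq_0)
    then show ?thesis by (simp add: r_def)
  qed
  have dr: "degree r \<le> q"
    using r by (intro degree_le) auto
  have split: "poly p = (\<lambda>t. poly r t + c * jacobi_poly q a b t)"
    by (auto simp: r_def poly_jacobi_as_poly[symmetric])
  have "jacobi_projection_at_0 a b (Suc q) (poly r) = poly r 0"
    using Suc.IH[OF r] jacobi_inner_poly_degree_le[OF a b dr] r[of q]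
    by (simp add: jacobi_projection_at_0_def)
  moreover have "jacobi_projection_at_0 a b (Suc q) (jacobi_poly q a b) = jacobi_poly q a b 0"
  proof -
    have "jacobi_inner a b (jacobi_poly i a b) (jacobi_poly q a b) = 0" if "i < q" for i
    proof -
      have "degree (jacobi_as_poly i a b) < q"
        using degree_jacobi_as_poly[of i a b] that by simp
      then have "jacobi_inner a b (jacobi_poly q a b) (poly (jacobi_as_poly i a b)) = 0"
        by (subst jacobi_inner_poly_degree_le[OF a b]) (auto simp: coeff_eq_0)
      then show ?thesis
        by (simp add: poly_jacobi_as_poly jacobi_inner_commute)
    qed
    moreover have "jacobi_inner a b (jacobi_poly q a b) (jacobi_poly q a b)
        = (jacobi_norm a b (jacobi_poly q a b))\<^sup>2"
      by (rule jacobi_norm_squared_eq_inner[OF a b continuous_on_jacobi_poly, symmetric])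
    ultimately show ?thesis
      using nz' by (simp add: jacobi_projection_at_0_def)
  qed
  moreover have "jacobi_projection_at_0 a b (Suc q) (poly p)
      = jacobi_projection_at_0 a b (Suc q) (poly r) + c * jacobi_projection_at_0 a b (Suc q)
          (jacobi_poly q a b)"
    unfolding split using a b by (intro jacobi_projection_add_mult) (auto intro!: continuous_intros)
  ultimately show ?case
    by (simp add: split)
qed

section \<open>The integral kernel of the estimator\<close>

text \<open>
  Expanding \<open>P_i\<close> by its definition, each product \<open>(t - 1)^(i-j) (t + 1)^j\<close> is absorbed into the
  weight and raises its exponents to \<open>a + i - j\<close> and \<open>b + j\<close>. The two generalized binomials divided
  by the squared norm collapse to an ordinary binomial times a quotient that depends only on \<open>i\<close>
  and the factor
  that gives the raised weight total mass one. This is the origin of the parameters \<open>\<alpha>_(i,j)\<close>,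
  \<open>\<beta>_j\<close> and of the quotient in
  \<^const>\<open>jacobi_Q\<close>.
\<close>
lemma jacobi_kernel_expansion:
  assumes a: "a > -1" and b: "b > -1" and t: "t \<in> {-1..1}"
  shows "jacobi_weight a b t * jacobi_poly i a b t / (jacobi_norm a b (jacobi_poly i a b))\<^sup>2
    = (\<Sum>j=0..i. (-1) ^ (i + j) * real (i choose j)
         * (if i = 0 then 1 else (2 * real i + a + b + 1) / (real i + a + b + 1))
         * (2 powr (- (real i + a + b + 1)) / Beta (a + real i - real j + 1) (b + real j + 1)
            * jacobi_weight (a + real i - real j) (b + real j) t))"
proof -
  define N where "N = ((2 * real i + a + b) gchoose i) * Beta (a + real i + 1) (b + real i + 1)"
  define \<kappa> where "\<kappa> = (if i = 0 then 1 else (2 * real i + a + b + 1) / (real i + a + b + 1))"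
  have N: "N \<noteq> 0"
    unfolding N_def by (rule gbinomial_times_Beta_nonzero[OF a b])
  have \<kappa>N: "\<kappa> * N = Gamma (a + real i + 1) * Gamma (b + real i + 1) / (fact i * Gamma (a + b
      + real i + 2))"
    unfolding \<kappa>_def N_def by (rule gbinomial_Beta_ratio[OF a b])
  have coeff: "((real i + a) gchoose j) * ((real i + b) gchoose (i - j)) / N
      = real (i choose j) * \<kappa> / Beta (a + real i - real j + 1) (b + real j + 1)" if "j \<le> i" for j
  proof -
    have 1: "((real i + a) gchoose j) = Gamma (a + real i + 1) / (fact j * Gamma (a + real i
        - real j + 1))"
      using a by (subst gbinomial_Gamma) (auto simp: add_ac algebra_simps elim!: nonpos_Ints_cases)
    have 2: "((real i + b) gchoose (i - j)) = Gamma (b + real i + 1) / (fact (i - j) * Gamma (b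
        + real j + 1))"
      using b that by (subst gbinomial_Gamma) (auto simp: add_ac algebra_simps of_nat_diff
          elim!: nonpos_Ints_cases)
    have 3: "Beta (a + real i - real j + 1) (b + real j + 1)
        = Gamma (a + real i - real j + 1) * Gamma (b + real j + 1) / Gamma (a + b + real i + 2)"
      by (simp add: Beta_def algebra_simps)
    have 4: "real (i choose j) = fact i / (fact j * fact (i - j))"
      using that by (simp add: binomial_fact)
    have pos: "Gamma (a + real i - real j + 1) > 0" "Gamma (b + real j + 1) > 0" "Gamma (a + b
        + real i + 2) > 0"
      using a b that by (auto intro!: Gamma_real_pos)
    have "((real i + a) gchoose j) * ((real i + b) gchoose (i - j))
        * Beta (a + real i - real j + 1) (b + real j + 1) = real (i choose j) * (\<kappa> * N)"
      unfolding 1 2 3 4 \<kappa>N using pos by (simp add: field_simps)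
    moreover have "Beta (a + real i - real j + 1) (b + real j + 1) \<noteq> 0"
      unfolding 3 using pos by simp
    ultimately show ?thesis using N by (simp add: field_simps)
  qed
  have weight: "jacobi_weight a b t * (((t - 1) / 2) ^ (i - j) * ((t + 1) / 2) ^ j)
      = (-1) ^ (i + j) / 2 ^ i * jacobi_weight (a + real i - real j) (b + real j) t" if "j
          \<le> i" for j
  \<comment> \<open>At the endpoints \<open>0 powr a = 0\<close> makes both weights vanish, whatever the exponents.\<close>
  proof (cases "t = 1 \<or> t = -1")
    case True
    then show ?thesis by (auto simp: jacobi_weight_def)
  next
    case False
    then have t': "1 - t > 0" "1 + t > 0" using t by auto
    have "((t - 1) / 2) ^ (i - j) * ((t + 1) / 2) ^ j = (- 1 * (1 - t)) ^ (i - j) * (1 + t) ^ j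
        / (2 ^ (i - j) * 2 ^ j)"
      by (simp add: power_divide add.commute)
    also have "(2 :: real) ^ (i - j) * 2 ^ j = 2 ^ i"
      using that by (simp add: power_add[symmetric])
    also have "(- 1 * (1 - t)) ^ (i - j) = (- 1) ^ (i - j) * (1 - t) ^ (i - j)"
      by (rule power_mult_distrib)
    also have "(- 1 :: real) ^ (i - j) = (- 1) ^ (i + j)"
      using that by (auto simp: minus_one_power_iff)
    finally have *: "((t - 1) / 2) ^ (i - j) * ((t + 1) / 2) ^ j
        = (- 1) ^ (i + j) * (1 - t) ^ (i - j) * (1 + t) ^ j / 2 ^ i" .
    have "(1 - t) powr (a + real i - real j) = (1 - t) powr (a + real (i - j))"
      using that by (simp only: of_nat_diff add_diff_eq)
    then show ?thesis
      unfolding * jacobi_weight_def using t' by (simp add: powr_add powr_realpow)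
  qed
  have scale: "1 / (2 powr (a + b + 1) * 2 ^ i) = 2 powr (- (real i + a + b + 1))"
  proof -
    have "2 powr (a + b + 1) * 2 ^ i = 2 powr (real i + a + b + 1)"
      by (simp add: powr_realpow[symmetric] powr_add[symmetric] algebra_simps)
    then show ?thesis
      by (simp only: powr_minus_divide)
  qed
  have "jacobi_weight a b t * jacobi_poly i a b t / (jacobi_norm a b (jacobi_poly i a b))\<^sup>2
     = (\<Sum>j=0..i. jacobi_weight a b t * (((t - 1) / 2) ^ (i - j) * ((t + 1) / 2) ^ j)
          * (((real i + a) gchoose j) * ((real i + b) gchoose (i - j)) / N) / 2 powr (a + b + 1))"
    unfolding jacobi_norm_squared[OF a b] N_def[symmetric] jacobi_poly_def sum_distrib_left
        sum_divide_distrib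
    by (intro sum.cong) (simp_all add: field_simps)
  also have "\<dots> = (\<Sum>j=0..i. (-1) ^ (i + j) * real (i choose j) * \<kappa>
         * (1 / (2 powr (a + b + 1) * 2 ^ i) / Beta (a + real i - real j + 1) (b + real j + 1)
            * jacobi_weight (a + real i - real j) (b + real j) t))"
    by (intro sum.cong refl) (simp add: weight coeff, simp add: mult_ac)
  finally show ?thesis
    unfolding scale \<kappa>_def .
qed

lemma jacobi_coefficient_expansion:
  assumes a: "a > -1" and b: "b > -1" and \<phi>: "continuous_on {-1..1} \<phi>"
  shows "jacobi_inner a b (jacobi_poly i a b) \<phi> / (jacobi_norm a b (jacobi_poly i a b))\<^sup>2
    = (\<Sum>j=0..i. (-1) ^ (i + j) * real (i choose j)
         * (if i = 0 then 1 else (2 * real i + a + b + 1) / (real i + a + b + 1))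
         * (2 powr (- (real i + a + b + 1)) / Beta (a + real i - real j + 1) (b + real j + 1)
            * jacobi_inner (a + real i - real j) (b + real j) (\<lambda>_. 1) \<phi>))"
    (is "?L = (\<Sum>j=0..i. ?c j * (?d j * ?I j))")
proof -
  have int: "(\<lambda>t. jacobi_weight (a + real i - real j) (b + real j) t * \<phi> t) integrable_on {-1..1}"
    if "j \<in> {0..i}" for j
    using jacobi_inner_integrable[of "a + real i - real j" "b
        + real j" "\<lambda>_. 1" \<phi>] a b \<phi> that by simp
  have "?L = integral {-1..1} (\<lambda>t. jacobi_weight a b t * jacobi_poly i a b t
                / (jacobi_norm a b (jacobi_poly i a b))\<^sup>2 * \<phi> t)"
    by (simp add: jacobi_inner_def flip: integral_divide)
  also have "\<dots> = integral {-1..1} (\<lambda>t. \<Sum>j=0..i. ?c j * ?d j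
      * (jacobi_weight (a + real i - real j) (b + real j) t * \<phi> t))"
  proof (rule integral_cong)
    fix t :: real assume t: "t \<in> {-1..1}"
    show "jacobi_weight a b t * jacobi_poly i a b t / (jacobi_norm a b (jacobi_poly i a b))\<^sup>2 * \<phi> t
      = (\<Sum>j=0..i. ?c j * ?d j * (jacobi_weight (a + real i - real j) (b + real j) t * \<phi> t))"
      unfolding jacobi_kernel_expansion[OF a b t] sum_distrib_right by (simp only: mult.assoc)
  qed
  also have "\<dots> = (\<Sum>j=0..i. ?c j * ?d j
      * integral {-1..1} (\<lambda>t. jacobi_weight (a + real i - real j) (b + real j) t * \<phi> t))"
    by (subst integral_sum)
       (simp_all only: finite_atLeastAtMost integral_mult_right integrable_on_mult_right int)
  finally show ?thesis
    by (simp add: jacobi_inner_def mult.assoc)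
qed

lemma jacobi_rho_times_continuous:
  assumes "a > -1" "b > -1" "continuous_on {-1..1} g"
  shows "(\<lambda>t. jacobi_rho n a b t * g t) absolutely_integrable_on {-1..1}"
proof -
  define c where "c = 2 powr (- (real n + a + b + 1)) * fact n / Beta (real n + a + 1) (real n
      + b + 1)"
  have "(\<lambda>t. jacobi_weight a b t * (c * jacobi_poly n a b t
      * g t)) absolutely_integrable_on {-1..1}"
    by (intro jacobi_weight_times_continuous_absolutely_integrable continuous_on_mult
          continuous_on_jacobi_poly continuous_on_const assms)
  moreover have "(\<lambda>t. jacobi_weight a b t * (c * jacobi_poly n a b t * g t))
      = (\<lambda>t. jacobi_rho n a b t * g t)"
    unfolding jacobi_rho_def c_def[symmetric] by (simp only: mult_ac)
  ultimately show ?thesis by simp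
qed

text \<open>
  Thus \<^const>\<open>jacobi_rho\<close> computes the mean of the \<open>n\<close>-th derivative against the normalized weight
  with exponents \<open>a + n\<close> and \<open>b + n\<close>.
\<close>
lemma jacobi_rho_by_parts:
  assumes a: "a > -1" and b: "b > -1"
    and cont: "\<And>k. k \<le> n \<Longrightarrow> continuous_on {-1..1} (G k)"
    and der: "\<And>k t. k < n \<Longrightarrow> -1 < t \<Longrightarrow> t < 1 \<Longrightarrow> (G k has_real_derivative G (Suc k) t) (at t)"
  shows "integral {-1..1} (\<lambda>t. jacobi_rho n a b t * G 0 t)
    = 2 powr (- (2 * real n + a + b + 1)) / Beta (a + real n + 1) (b + real n + 1)
        * jacobi_inner (a + real n) (b + real n) (\<lambda>_. 1) (G n)"
proof -
  define c where "c = 2 powr (- (real n + a + b + 1)) * fact n / Beta (a + real n + 1) (b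
      + real n + 1)"
  have "(\<lambda>t. jacobi_rho n a b t * G 0 t) = (\<lambda>t. c * (jacobi_weight a b t * jacobi_poly n a b t
      * G 0 t))"
    by (simp add: jacobi_rho_def c_def fun_eq_iff add_ac)
  then have "integral {-1..1} (\<lambda>t. jacobi_rho n a b t * G 0 t) = c
      * jacobi_inner a b (jacobi_poly n a b) (G 0)"
    by (simp add: jacobi_inner_def)
  also have "\<dots> = c * (jacobi_inner (a + real n) (b + real n) (\<lambda>_. 1) (G n) / (2 ^ n * fact n))"
    using jacobi_inner_by_parts[where G = G and n = n, OF a b cont der] by simp
  also have "\<dots> = 2 powr (- (real n + a + b + 1)) / 2 powr real n / Beta (a + real n + 1) (b
      + real n + 1)
        * jacobi_inner (a + real n) (b + real n) (\<lambda>_. 1) (G n)"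
    by (simp add: c_def powr_realpow)
  also have "2 powr (- (real n + a + b + 1)) / 2 powr real n = 2 powr (- (2 * real n + a + b + 1))"
    by (simp add: powr_diff[symmetric] algebra_simps)
  finally show ?thesis .
qed

lemma jacobi_Q_times_continuous:
  assumes "\<alpha> > -1" "\<beta> > -1" "continuous_on {-1..1} g"
  shows "(\<lambda>t. jacobi_Q \<alpha> \<beta> n q t * g t) absolutely_integrable_on {-1..1}"
proof -
  define c where "c i j = jacobi_poly i (\<alpha> + real n) (\<beta> + real n) 0 * ((-1) ^ (i + j)
      * real (i choose j)
           * (if i = 0 then 1
              else (2 * real i + \<alpha> + \<beta> + 2 * real n + 1) / (real i + \<alpha> + \<beta> + 2 * real n
                  + 1)))" for i j
  have "(\<lambda>t. \<Sum>i=0..q. \<Sum>j=0..i. c i j * (jacobi_rho n (\<alpha> + real i - real j) (\<beta> + real j) t * g t))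
          absolutely_integrable_on {-1..1}"
    using assms
    by (intro absolutely_integrable_sum set_integrable_mult_right jacobi_rho_times_continuous) auto
  moreover have "(\<lambda>t. \<Sum>i=0..q. \<Sum>j=0..i. c i j * (jacobi_rho n (\<alpha> + real i - real j) (\<beta>
      + real j) t * g t))
      = (\<lambda>t. jacobi_Q \<alpha> \<beta> n q t * g t)"
    unfolding jacobi_Q_def c_def sum_distrib_left sum_distrib_right by (simp only: mult.assoc)
  ultimately show ?thesis by simp
qed

text \<open>
  Integration by parts in each \<^const>\<open>jacobi_rho\<close> summand of \<^const>\<open>jacobi_Q\<close> produces exactly
  the raised weights that occur in the expansion of the projection coefficients.
\<close>
lemma jacobi_Q_represents_projection:
  assumes \<alpha>: "\<alpha> > -1" and \<beta>: "\<beta> > -1"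
    and cont: "\<And>k. k \<le> n \<Longrightarrow> continuous_on {-1..1} (G k)"
    and der: "\<And>k t. k < n \<Longrightarrow> -1 < t \<Longrightarrow> t < 1 \<Longrightarrow> (G k has_real_derivative G (Suc k) t) (at t)"
  shows "integral {-1..1} (\<lambda>t. jacobi_Q \<alpha> \<beta> n q t * G 0 t)
           = jacobi_projection_at_0 (\<alpha> + real n) (\<beta> + real n) (Suc q) (G n)"
proof -
  define a where "a = \<alpha> + real n"
  define b where "b = \<beta> + real n"
  have ab: "a > -1" "b > -1" using \<alpha> \<beta> by (auto simp: a_def b_def)
  define c where "c i j = (-1) ^ (i + j) * real (i choose j)
           * (if i = 0 then 1 else (2 * real i + a + b + 1) / (real i + a + b + 1))" for i j
  define \<rho> where "\<rho> i j t = jacobi_rho n (\<alpha> + real i - real j) (\<beta> + real j) t" for i j t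
  define K where "K i j = integral {-1..1} (\<lambda>t. \<rho> i j t * G 0 t)" for i j
  have Q: "jacobi_Q \<alpha> \<beta> n q t * G 0 t
      = (\<Sum>i=0..q. jacobi_poly i a b 0 * (\<Sum>j=0..i. c i j * (\<rho> i j t * G 0 t)))" for t
  proof -
    have c: "c i j = (-1) ^ (i + j) * real (i choose j)
        * (if i = 0 then 1
           else (2 * real i + \<alpha> + \<beta> + 2 * real n + 1) / (real i + \<alpha> + \<beta> + 2 * real n + 1))" for i j
    proof -
      have "2 * real i + a + b + 1 = 2 * real i + \<alpha> + \<beta> + 2 * real n + 1"
           "real i + a + b + 1 = real i + \<alpha> + \<beta> + 2 * real n + 1"
        by (auto simp: a_def b_def)
      then show ?thesis
        by (simp only: c_def)
    qed
    show ?thesis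
      unfolding jacobi_Q_def c \<rho>_def a_def b_def
      by (simp only: sum_distrib_left sum_distrib_right mult.assoc)
  qed
  have int: "(\<lambda>t. \<rho> i j t * G 0 t) integrable_on {-1..1}" if "j \<in> {0..i}" for i j
    unfolding \<rho>_def using that \<alpha> \<beta> cont[of 0]
    by (intro set_lebesgue_integral_eq_integral(1) jacobi_rho_times_continuous) auto
  have K: "K i j = 2 powr (- (real i + a + b + 1)) / Beta (a + real i - real j + 1) (b + real j + 1)
              * jacobi_inner (a + real i - real j) (b + real j) (\<lambda>_. 1) (G n)" if "j \<in> {0..i}"
                  for i j
  proof -
    have "\<alpha> + real i - real j > -1" "\<beta> + real j > -1" using that \<alpha> \<beta> by auto
    from jacobi_rho_by_parts[where G = G and n = n, OF this cont der] show ?thesis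
      unfolding K_def \<rho>_def by (simp add: a_def b_def algebra_simps)
  qed
  have "integral {-1..1} (\<lambda>t. jacobi_Q \<alpha> \<beta> n q t * G 0 t)
      = (\<Sum>i=0..q. jacobi_poly i a b 0 * (\<Sum>j=0..i. c i j * K i j))"
    unfolding Q K_def
    by (intro integral_unique has_integral_sum has_integral_mult_right integrable_integral int)
       auto
  also have "\<dots> = (\<Sum>i=0..q. jacobi_poly i a b 0
      * (jacobi_inner a b (jacobi_poly i a b) (G n) / (jacobi_norm a b (jacobi_poly i a b))\<^sup>2))"
    unfolding jacobi_coefficient_expansion[OF ab cont[OF order_refl]] c_def
    by (intro sum.cong arg_cong2[where f = "(*)"] refl) (simp add: K)
  also have "\<dots> = jacobi_projection_at_0 a b (Suc q) (G n)"
    unfolding jacobi_projection_at_0_def by (rule sum.cong) (auto simp: mult.commute)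
  finally show ?thesis
    by (simp add: a_def b_def)
qed

lemma affine_estimator_eq_projection:
  "affine_estimator n h \<alpha> \<beta> q f x
     = jacobi_projection_at_0 (\<alpha> + real n) (\<beta> + real n) (Suc q) (\<lambda>t. (deriv ^^ n) f (x + h * t))"
  unfolding affine_estimator_def jacobi_projection_at_0_def by (rule sum.cong) auto

section \<open>Error bound and convergence order\<close>

text \<open>
  Lagrange's form of the remainder. At \<open>t = 0\<close>, which Lagrange's form excludes, both sides vanish.
\<close>
lemma Taylor_bound_higher_deriv:
  fixes F :: "nat \<Rightarrow> real \<Rightarrow> real"
  assumes der: "\<And>k y. k < N \<Longrightarrow> y \<in> {x - h..x + h} \<Longrightarrow> (F k has_real_derivative F (Suc k) y) (at y)"
    and N: "N > 0" and h: "h > 0" and t: "t \<in> {-1..1}"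
    and M: "\<And>y. y \<in> {x - h..x + h} \<Longrightarrow> \<bar>F N y\<bar> \<le> M"
  shows "\<bar>F 0 (x + h * t) - (\<Sum>m<N. F m x / fact m * (h * t) ^ m)\<bar> \<le> M / fact N * h ^ N * \<bar>t ^ N\<bar>"
proof (cases "t = 0")
  case True
  have "(\<Sum>m<N. F m x / fact m * (0::real) ^ m) = F 0 x"
    using N by (cases N) (simp_all add: sum.lessThan_Suc_shift del: sum.lessThan_Suc)
  then show ?thesis using True N by (simp add: zero_power)
next
  case False
  have ht: "\<bar>h * t\<bar> \<le> h"
    using h t by (auto simp: abs_mult abs_le_iff)
  have xht: "x - h \<le> x + h * t" "x + h * t \<le> x + h" "x + h * t \<noteq> x"
    using ht h False by (auto simp: abs_le_iff)
  have D: "\<forall>m y. m < N \<and> x - h \<le> y \<and> y \<le> x + h \<longrightarrow> DERIV (F m) y :> F (Suc m) y"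
    using der by simp
  have "x - h \<le> x" "x \<le> x + h"
    using h by auto
  from Taylor[OF N refl D this xht]
  obtain s where s: "if x + h * t < x then x + h * t < s \<and> s < x else x < s \<and> s < x + h * t"
      and eq: "F 0 (x + h * t) = (\<Sum>m<N. F m x / fact m * (x + h * t - x) ^ m) + F N s / fact N
          * (x + h * t - x) ^ N"
    by blast
  have "s \<in> {x - h..x + h}"
    using s ht by (auto split: if_splits)
  then have "\<bar>F N s\<bar> \<le> M" by (rule M)
  then have "\<bar>F N s\<bar> * (h ^ N * \<bar>t ^ N\<bar>) / fact N \<le> M * (h ^ N * \<bar>t ^ N\<bar>) / fact N"
    using h by (intro divide_right_mono mult_right_mono) auto
  moreover have "\<bar>F 0 (x + h * t) - (\<Sum>m<N. F m x / fact m * (h * t) ^ m)\<bar> = \<bar>F N s\<bar> * (h ^ N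
      * \<bar>t ^ N\<bar>) / fact N"
    using h by (simp add: eq abs_mult power_mult_distrib)
  ultimately show ?thesis by simp
qed

text \<open>
  Subtract from \<open>t \<mapsto> f (x + h t)\<close> its Taylor polynomial of degree \<open>n + q\<close> at \<open>0\<close>. The \<open>n\<close>-th
  derivative of this polynomial has degree at most \<open>q\<close>, so the projection reproduces its value at
  \<open>0\<close>, which is \<open>h^n f^(n)(x)\<close>. The error is therefore \<open>h^-n\<close> times the integral of the remainder
  against \<^const>\<open>jacobi_Q\<close>.
\<close>
lemma affine_estimator_error:
  assumes C: "C_k_on (n + 1 + q) I f" and \<alpha>: "\<alpha> > -1" and \<beta>: "\<beta> > -1"
    and h: "h > 0" and I: "{x - h..x + h} \<subseteq> I"
    and M: "\<And>y. y \<in> {x - h..x + h} \<Longrightarrow> \<bar>(deriv ^^ (n + 1 + q)) f y\<bar> \<le> M"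
  shows "\<bar>affine_estimator n h \<alpha> \<beta> q f x - (deriv ^^ n) f x\<bar>
    \<le> M / fact (n + 1 + q) * integral {-1..1} (\<lambda>t. \<bar>t ^ (n + 1 + q) * jacobi_Q \<alpha> \<beta> n q t\<bar>)
        * h ^ (q + 1)"
proof -
  define N where "N = n + 1 + q"
  define F where "F k = (deriv ^^ k) f" for k
  \<comment> \<open>\<open>T k\<close> is the Taylor polynomial of \<open>t \<mapsto> f^(k) (x + h t)\<close>, and the remainder \<open>G k\<close> is scaled
      so that
      \<open>G n\<close> carries no power of \<open>h\<close> and \<open>G (Suc k)\<close> is the derivative of \<open>G k\<close>.\<close>
  define T where "T k = (\<Sum>m<N - k. monom (F (k + m) x / fact m * h ^ m) m)" for k
  define G where "G k t = h ^ k / h ^ n * (F k (x + h * t) - poly (T k) t)" for k t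
  define a where "a = \<alpha> + real n"
  define b where "b = \<beta> + real n"
  have ab: "a > -1" "b > -1" using \<alpha> \<beta> by (auto simp: a_def b_def)
  have dF: "(F k has_real_derivative F (Suc k) y) (at y)" if "k < N" "y \<in> {x - h..x + h}" for k y
    using C that I unfolding C_k_on_def F_def N_def by (auto simp:
        DERIV_deriv_iff_real_differentiable)
  have inI: "x + h * t \<in> {x - h..x + h}" if "t \<in> {-1..1}" for t
  proof -
    have "\<bar>h * t\<bar> \<le> h * 1"
      unfolding abs_mult using h that by (intro mult_mono) auto
    then show ?thesis by (auto simp: abs_le_iff)
  qed
  have dFh: "((\<lambda>t. F k (x + h * t)) has_real_derivative h * F (Suc k) (x + h * t)) (at t)"
    if "k < N" "t \<in> {-1..1}" for k t
  proof -
    have "((\<lambda>t. x + h * t) has_real_derivative h) (at t)"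
      by (auto intro!: derivative_eq_intros)
    from DERIV_chain2[OF dF[OF that(1) inI[OF that(2)]] this] show ?thesis
      by (simp add: mult.commute)
  qed
  have cF: "continuous_on {-1..1} (\<lambda>t. F k (x + h * t))" if "k < N" for k
    using dFh[OF that] by (meson DERIV_isCont continuous_at_imp_continuous_on)
  have coeffT: "coeff (T k) m = (if m < N - k then F (k + m) x / fact m * h ^ m else 0)" for k m
    by (simp add: T_def coeff_sum)
  have dT: "pderiv (T k) = smult h (T (Suc k))" for k
  proof (rule poly_eqI)
    fix m
    have "real (Suc m) * (F (k + Suc m) x / fact (Suc m) * h ^ Suc m) = h * (F (Suc k + m) x
        / fact m * h ^ m)"
      by (simp add: field_simps del: of_nat_Suc)
    then show "coeff (pderiv (T k)) m = coeff (smult h (T (Suc k))) m"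
      by (auto simp: coeff_pderiv coeffT simp del: of_nat_Suc)
  qed
  have dG: "(G k has_real_derivative G (Suc k) t) (at t)" if "k < n" "-1 < t" "t < 1" for k t
  proof -
    have "(G k has_real_derivative h ^ k / h ^ n * (h * F (Suc k) (x + h * t)
        - poly (pderiv (T k)) t)) (at t)"
      unfolding G_def
      by (intro DERIV_cmult DERIV_diff dFh poly_DERIV) (use that in \<open>auto simp: N_def\<close>)
    also have "h ^ k / h ^ n * (h * F (Suc k) (x + h * t) - poly (pderiv (T k)) t) = G (Suc k) t"
      by (simp add: G_def dT algebra_simps)
    finally show ?thesis .
  qed
  have cG: "continuous_on {-1..1} (G k)" if "k \<le> n" for k
    unfolding G_def using that by (intro continuous_intros cF) (auto simp: N_def)
  have "G n = (\<lambda>t. F n (x + h * t) + (-1) * poly (T n) t)"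
    using h by (auto simp: G_def)
  then have "jacobi_projection_at_0 a b (Suc q) (G n)
      = jacobi_projection_at_0 a b (Suc q) (\<lambda>t. F n (x + h * t)) + (-1)
          * jacobi_projection_at_0 a b (Suc q) (poly (T n))"
    using jacobi_projection_add_mult[OF ab cF[of n], of "poly (T n)" "Suc q" "-1"]
    by (simp add: N_def continuous_intros)
  also have "jacobi_projection_at_0 a b (Suc q) (poly (T n)) = poly (T n) 0"
    by (rule jacobi_projection_poly[OF ab]) (simp add: coeffT N_def)
  also have "poly (T n) 0 = F n x"
    by (simp add: poly_0_coeff_0 coeffT N_def)
  finally have err: "affine_estimator n h \<alpha> \<beta> q f x - (deriv ^^ n) f x
      = integral {-1..1} (\<lambda>t. jacobi_Q \<alpha> \<beta> n q t * G 0 t)"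
    using jacobi_Q_represents_projection[where G = G and n = n, OF \<alpha> \<beta> cG dG]
    by (simp add: affine_estimator_eq_projection a_def b_def F_def)
  define c where "c = M / fact N * h ^ (q + 1)"
  have "\<bar>G 0 t\<bar> \<le> c * \<bar>t ^ N\<bar>" if "t \<in> {-1..1}" for t
  proof -
    have "poly (T 0) t = (\<Sum>m<N. F m x / fact m * (h * t) ^ m)"
      by (simp add: T_def poly_sum poly_monom power_mult_distrib mult.assoc)
    then have "\<bar>F 0 (x + h * t) - poly (T 0) t\<bar> \<le> M / fact N * h ^ N * \<bar>t ^ N\<bar>"
      using Taylor_bound_higher_deriv[of N x h F t M] dF h that M by (simp add: N_def F_def)
    then have "\<bar>F 0 (x + h * t) - poly (T 0) t\<bar> / h ^ n \<le> M / fact N * h ^ N * \<bar>t ^ N\<bar> / h ^ n"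
      using h by (intro divide_right_mono) auto
    also have "M / fact N * h ^ N * \<bar>t ^ N\<bar> / h ^ n = c * \<bar>t ^ N\<bar>"
      using h by (simp add: c_def N_def power_add)
    finally show ?thesis using h by (simp add: G_def abs_mult)
  qed
  then have le: "norm (jacobi_Q \<alpha> \<beta> n q t * G 0 t) \<le> c * \<bar>t ^ N * jacobi_Q \<alpha> \<beta> n q t\<bar>"
    if "t \<in> {-1..1}" for t
    using mult_left_mono[of "\<bar>G 0 t\<bar>" "c * \<bar>t ^ N\<bar>" "\<bar>jacobi_Q \<alpha> \<beta> n q t\<bar>"] that
    by (simp add: abs_mult mult_ac)
  have intQ: "(\<lambda>t. \<bar>t ^ N * jacobi_Q \<alpha> \<beta> n q t\<bar>) integrable_on {-1..1}"
  proof -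
    have "(\<lambda>t. jacobi_Q \<alpha> \<beta> n q t * t ^ N) absolutely_integrable_on {-1..1}"
      by (intro jacobi_Q_times_continuous[OF \<alpha> \<beta>] continuous_intros)
    then have "(\<lambda>t. \<bar>jacobi_Q \<alpha> \<beta> n q t * t ^ N\<bar>) integrable_on {-1..1}"
      by (intro set_lebesgue_integral_eq_integral(1) set_integrable_abs)
    then show ?thesis
      by (simp only: mult.commute)
  qed
  have "(\<lambda>t. jacobi_Q \<alpha> \<beta> n q t * G 0 t) integrable_on {-1..1}"
    by (intro set_lebesgue_integral_eq_integral(1) jacobi_Q_times_continuous[OF \<alpha> \<beta>] cG) simp
  then have "norm (integral {-1..1} (\<lambda>t. jacobi_Q \<alpha> \<beta> n q t * G 0 t))
      \<le> integral {-1..1} (\<lambda>t. c * \<bar>t ^ N * jacobi_Q \<alpha> \<beta> n q t\<bar>)"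
    by (rule integral_norm_bound_integral[OF _ integrable_on_mult_right[OF intQ] le])
  then show ?thesis
    by (simp add: err c_def N_def mult_ac)
qed

theorem proposition10:
  fixes I :: "real set" and n q :: nat and \<alpha> \<beta> :: real and f :: "real \<Rightarrow> real"
  assumes "open I" and "is_interval I"
    and "\<alpha> > -1" and "\<beta> > -1"
    and "C_k_on (n + 1 + q) I f"
  shows "(\<forall>x\<in>I. (\<lambda>h. affine_estimator n h \<alpha> \<beta> q f x - (deriv ^^ n) f x)
                   \<in> O[at_right 0](\<lambda>h. h ^ (q + 1)))
       \<and> (\<forall>M>0. (\<forall>x\<in>I. \<bar>(deriv ^^ (n + 1 + q)) f x\<bar> \<le> M) \<longrightarrow>
            (\<forall>h>0. sup_norm_on (inner_part I h)
                      (\<lambda>x. affine_estimator n h \<alpha> \<beta> q f x - (deriv ^^ n) f x)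
                    \<le> ereal (M / fact (n + 1 + q)
                         * integral {-1..1} (\<lambda>t. \<bar>t ^ (n + 1 + q) * jacobi_Q \<alpha> \<beta> n q t\<bar>)
                         * h ^ (q + 1))))"
proof (intro conjI ballI allI impI)
  fix x assume "x \<in> I"
  then obtain e where e: "e > 0" "cball x e \<subseteq> I"
    using assms(1) open_contains_cball by blast
  have "continuous_on (cball x e) ((deriv ^^ (n + 1 + q)) f)"
    using assms(5) e(2) unfolding C_k_on_def by (blast intro: continuous_on_subset)
  then have "bounded ((deriv ^^ (n + 1 + q)) f ` cball x e)"
    by (intro compact_imp_bounded compact_continuous_image) auto
  \<comment> \<open>Continuity on a compact neighbourhood of \<open>x\<close> supplies a local bound.\<close>
  then obtain M where M: "\<And>y. y \<in> cball x e \<Longrightarrow> \<bar>(deriv ^^ (n + 1 + q)) f y\<bar> \<le> M"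
    unfolding bounded_iff by (metis imageI real_norm_def)
  define C where "C = M / fact (n + 1 + q)
    * integral {-1..1} (\<lambda>t. \<bar>t ^ (n + 1 + q) * jacobi_Q \<alpha> \<beta> n q t\<bar>)"
  have "norm (affine_estimator n h \<alpha> \<beta> q f x - (deriv ^^ n) f x) \<le> C * norm (h ^ (q + 1))"
    if h: "0 < h" "h < e" for h
  proof -
    have sub: "{x - h..x + h} \<subseteq> cball x e"
      using h by (auto simp: cball_eq_atLeastAtMost)
    have "\<bar>affine_estimator n h \<alpha> \<beta> q f x - (deriv ^^ n) f x\<bar> \<le> C * h ^ (q + 1)"
      unfolding C_def using sub e M
      by (intro affine_estimator_error[OF assms(5,3,4) h(1)]) auto
    then show ?thesis using h by simp
  qed
  then have "eventually (\<lambda>h. norm (affine_estimator n h \<alpha> \<beta> q f x - (deriv ^^ n) f x)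
      \<le> C * norm (h ^ (q + 1))) (at_right 0)"
    using e(1) by (auto simp: eventually_at_right_field)
  then show "(\<lambda>h. affine_estimator n h \<alpha> \<beta> q f x - (deriv ^^ n) f x) \<in> O[at_right 0](\<lambda>h. h ^ (q
      + 1))"
    by (rule bigoI)
next
  fix M h :: real
  assume "M > 0" and M: "\<forall>x\<in>I. \<bar>(deriv ^^ (n + 1 + q)) f x\<bar> \<le> M" and h: "h > 0"
  show "sup_norm_on (inner_part I h) (\<lambda>x. affine_estimator n h \<alpha> \<beta> q f x - (deriv ^^ n) f x)
      \<le> ereal (M / fact (n + 1 + q)
          * integral {-1..1} (\<lambda>t. \<bar>t ^ (n + 1 + q) * jacobi_Q \<alpha> \<beta> n q t\<bar>) * h ^ (q + 1))"
    unfolding sup_norm_on_def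
  proof (rule SUP_least)
    fix x assume "x \<in> inner_part I h"
    then have "{x - h..x + h} \<subseteq> I" by (auto simp: inner_part_def)
    then show "ereal \<bar>affine_estimator n h \<alpha> \<beta> q f x - (deriv ^^ n) f x\<bar>
      \<le> ereal (M / fact (n + 1 + q)
          * integral {-1..1} (\<lambda>t. \<bar>t ^ (n + 1 + q) * jacobi_Q \<alpha> \<beta> n q t\<bar>) * h ^ (q + 1))"
      unfolding ereal_less_eq using M
      by (intro affine_estimator_error[OF assms(5,3,4) h]) auto
  qed
qed

end
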